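(* For all integers $m,n\ge 7$ with $m\equiv n\equiv 3\pmod 4$, there exists a Heffter array $H(m,n)$.
   Context: A (tight) Heffter array $H(m,n)$ is an $m\times n$ array with every cell filled by an element of $\mathbb{Z}_{2mn+1}$ such that every row and every column sums to $0$ modulo $2mn+1$, and no element of any pair $\{x,-x\}$ appears twice (using representatives $-mn,\dots,mn$, entries are nonzero and each of $1,\dots,mn$ appears exactly once up to sign). *)

theory Defs
  imports "HOL-Number_Theory.Cong"
begin

text \<open>
  An \<open>m \<times> n\<close> array is a function \<open>A\<close> of row index \<open>i < m\<close> and column index \<open>j < n\<close>; its values
  elsewhere are irrelevant. Elements of \<open>\<int>/(2mn+1)\<close> are given by their unique integer
  representatives in \<open>{-mn..mn}\<close>, so that \<open>x\<close> and \<open>-x\<close> both occur among the representatives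
  and the classes \<open>{x, -x}\<close> with \<open>x \<noteq> 0\<close> correspond to \<open>1, \<dots>, mn\<close>.
\<close>

definition heffter_array :: "nat \<Rightarrow> nat \<Rightarrow> (nat \<Rightarrow> nat \<Rightarrow> int) \<Rightarrow> bool" where
  "heffter_array m n A \<longleftrightarrow>
     (\<forall>i<m. \<forall>j<n. A i j \<in> {- int (m * n)..int (m * n)} \<and> A i j \<noteq> 0) \<and>
     (\<forall>i<m. [(\<Sum>j<n. A i j) = 0] (mod int (2 * m * n + 1))) \<and>
     (\<forall>j<n. [(\<Sum>i<m. A i j) = 0] (mod int (2 * m * n + 1))) \<and>
     (\<forall>x\<in>{1..int (m * n)}. \<exists>!(i, j). i < m \<and> j < n \<and> (A i j = x \<or> A i j = - x))"

end

theory Submission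
  imports Defs
begin

text \<open>
  Write \<open>M = 2 m n + 1\<close>. Since \<open>M\<close> is odd, the class \<open>{x, -x}\<close> of an odd \<open>x\<close> is also represented
  by the even number \<open>M - x\<close>. So it suffices to fill the array with integers whose rows and
  columns sum to exactly \<open>0\<close> and whose absolute values are \<open>1, \<dots>, K - 2\<close>, then \<open>K\<close>, and then
  consecutive even numbers \<open>K + 2, K + 4, \<dots>\<close>, each once: the even ones beyond \<open>m n\<close> stand for the
  missing odd classes. Skipping \<open>K - 1\<close> makes the total even, as zero sums require.

  Let \<open>m = 7 + 4 a\<close>, \<open>n = 7 + 4 b\<close> and \<open>R = a + b + 1\<close>. The first three rows and columns form an
  L-shape, which is tiled by a zero-sum \<open>3 \<times> 7\<close> core and \<open>R\<close> zero-sum \<open>3 \<times> 4\<close> strips, \<open>b\<close> of them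
  horizontal and \<open>a + 1\<close> transposed. It receives the values up to \<open>K = 12 R + 22\<close>. The remaining
  cells are tiled by \<open>4 \<times> 4\<close> squares carrying the signs of \<open>\<epsilon> \<epsilon>\<^sup>T\<close> with \<open>\<epsilon> = (1, -1, -1, 1)\<close>; since \<open>\<epsilon>\<close>
  is orthogonal to all arithmetic progressions of length four, any sixteen values in arithmetic
  progression give zero sums there.
\<close>

section \<open>Heffter arrays by counting\<close>

text \<open>
  As there are as many cells as classes \<open>{x, -x}\<close>, covering every class already forces the
  entries to be nonzero and every class to occur only once.
\<close>

lemma heffter_arrayI:
  fixes m n :: nat and B :: "nat \<Rightarrow> nat \<Rightarrow> int"
  defines "M \<equiv> int (2 * m * n + 1)"
  assumes rows: "\<And>i. i < m \<Longrightarrow> [(\<Sum>j<n. B i j) = 0] (mod M)"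
    and cols: "\<And>j. j < n \<Longrightarrow> [(\<Sum>i<m. B i j) = 0] (mod M)"
    and cover: "\<And>x. 1 \<le> x \<Longrightarrow> x \<le> int (m * n) \<Longrightarrow>
      \<exists>i<m. \<exists>j<n. [B i j = x] (mod M) \<or> [B i j = - x] (mod M)"
  shows "\<exists>A. heffter_array m n A"
proof
  define N where "N = int (m * n)"
  \<comment> \<open>The shift by \<open>N\<close> before and after reduction selects the
    representative in \<open>{-N..N}\<close> instead of \<open>{0..<M}\<close>.\<close>
  define A where "A i j = (B i j + N) mod M - N" for i j
  have M: "M = 2 * N + 1" by (simp add: M_def N_def)
  have N0: "N \<ge> 0" by (simp add: N_def)
  have range: "A i j \<in> {-N..N}" for i j
  proof -
    have "0 \<le> (B i j + N) mod M" "(B i j + N) mod M < M"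
      using pos_mod_sign[of M] pos_mod_bound[of M] M N0 by auto
    then show ?thesis unfolding A_def using M by auto
  qed
  have AB: "[A i j = B i j] (mod M)" for i j
    unfolding A_def cong_def by (metis add_diff_cancel_right' mod_diff_left_eq)
  have inv: "A i j = y" if "[B i j = y] (mod M)" "y \<in> {-N..N}" for i j y
  proof -
    have "(B i j + N) mod M = (y + N) mod M"
      using that(1) by (metis cong_add_rcancel cong_def)
    also have "\<dots> = y + N" using that(2) M by (intro mod_pos_pos_trivial) auto
    finally show ?thesis by (simp add: A_def)
  qed
  define S where "S = {..<m} \<times> {..<n}"
  define f where "f = (\<lambda>(i, j). \<bar>A i j\<bar>)"
  have finS: "finite S" and cardS: "card S = m * n" by (simp_all add: S_def)
  have sub: "{1..N} \<subseteq> f ` S"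
  proof
    fix x assume x: "x \<in> {1..N}"
    then obtain i j where ij: "i < m" "j < n" "[B i j = x] (mod M) \<or> [B i j = - x] (mod M)"
      using cover[of x] by (auto simp: N_def)
    then have "A i j = x \<or> A i j = - x" using inv[of i j x] inv[of i j "- x"] x by auto
    then have "x = f (i, j)" using x by (auto simp: f_def)
    then show "x \<in> f ` S" using ij by (auto simp: S_def)
  qed
  have le: "card (f ` S) \<le> m * n" using card_image_le[OF finS, of f] cardS by simp
  have cardN: "card {1..N} = m * n" by (simp add: N_def del: of_nat_mult)
  have img: "f ` S = {1..N}"
    using card_seteq[OF finite_imageI[OF finS] sub] le cardN by simp
  have inj: "inj_on f S"
    using eq_card_imp_inj_on[OF finS, of f] cardS cardN img by simp
  show "heffter_array m n A"
    unfolding heffter_array_def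
  proof (intro conjI allI impI ballI)
    fix i j assume ij: "i < m" "j < n"
    show "A i j \<in> {- int (m * n)..int (m * n)}" using range by (simp add: N_def)
    have "f (i, j) \<in> {1..N}" using ij img by (auto simp: S_def)
    then show "A i j \<noteq> 0" by (auto simp: f_def)
  next
    fix i assume "i < m"
    have "[(\<Sum>j<n. A i j) = (\<Sum>j<n. B i j)] (mod M)" by (intro cong_sum AB)
    then show "[(\<Sum>j<n. A i j) = 0] (mod int (2 * m * n + 1))"
      using rows[OF \<open>i < m\<close>] cong_trans unfolding M_def by blast
  next
    fix j assume "j < n"
    have "[(\<Sum>i<m. A i j) = (\<Sum>i<m. B i j)] (mod M)" by (intro cong_sum AB)
    then show "[(\<Sum>i<m. A i j) = 0] (mod int (2 * m * n + 1))"
      using cols[OF \<open>j < n\<close>] cong_trans unfolding M_def by blast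
  next
    fix x assume x: "x \<in> {1..int (m * n)}"
    have iff: "i < m \<and> j < n \<and> (A i j = x \<or> A i j = - x) \<longleftrightarrow> (i, j) \<in> S \<and> f (i, j) = x" for i j
      using x by (auto simp: S_def f_def)
    have "x \<in> f ` S" using x img by (simp add: N_def)
    then obtain i j where ij: "(i, j) \<in> S" "f (i, j) = x" by auto
    show "\<exists>!(i, j). i < m \<and> j < n \<and> (A i j = x \<or> A i j = - x)"
      unfolding iff
    proof (rule ex1I[of _ "(i, j)"])
      show "case (i, j) of (i, j) \<Rightarrow> (i, j) \<in> S \<and> f (i, j) = x" using ij by simp
      fix p assume "case p of (i, j) \<Rightarrow> (i, j) \<in> S \<and> f (i, j) = x"
      then show "p = (i, j)" using inj ij by (auto dest: inj_onD)
    qed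
  qed
qed

section \<open>The integer array\<close>

text \<open>
  For \<open>0 \<le> r < R\<close> the absolute values in the strips run through eight intervals and four
  progressions of step 2, and the core takes the values left over in between. Both arrays
  were found by computer search.
\<close>

definition core :: "int \<Rightarrow> nat \<Rightarrow> nat \<Rightarrow> int" where
  "core R i j =
    [[3*R+6, 9*R+13, 6*R+10, -(11*R+17), -(9*R+15), 9*R+14, -(7*R+11)],
     [9*R+16, -(12*R+20), -(8*R+12), -1, 12*R+19, -(3*R+5), 2*R+3],
     [-(12*R+22), 3*R+7, 2*R+2, 11*R+18, -(3*R+4), -(6*R+9), 5*R+8]] ! i ! j"

definition strip :: "int \<Rightarrow> int \<Rightarrow> nat \<Rightarrow> nat \<Rightarrow> int" where
  "strip R r i j =
    [[7*R+12+r, -(11*R+16-r), -(2*R+4+r), 6*R+8-r],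
     [-(9*R+12-r), 11*R+19+r, 7*R+10-r, -(9*R+17+r)],
     [2*R-2*r, -(3+2*r), -(5*R+6-2*r), 3*R+9+2*r]] ! i ! j"

definition square :: "nat \<Rightarrow> nat \<Rightarrow> int" where
  "square i j = [1, -1, -1, 1] ! i * [1, -1, -1, 1] ! j"

text \<open>
  The strips \<open>0, \<dots>, b - 1\<close> are horizontal and continue the core to the right, the strips
  \<open>b, \<dots>, a + b\<close> are transposed and stacked below its first three columns.
\<close>

definition heffter_int :: "nat \<Rightarrow> nat \<Rightarrow> nat \<Rightarrow> nat \<Rightarrow> int" where
  "heffter_int a b i j = (let R = int a + int b + 1 in
    if i < 3 then
      if j < 7 then core R i j else strip R (int ((j - 7) div 4)) i ((j - 7) mod 4)
    else if j < 3 then strip R (int (b + (i - 3) div 4)) j ((i - 3) mod 4)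
    else square ((i - 3) mod 4) ((j - 3) mod 4) *
      (12 * R + 24 + 2 * int (16 * ((i - 3) div 4 * (b + 1) + (j - 3) div 4)
        + 4 * ((i - 3) mod 4) + (j - 3) mod 4)))"

section \<open>Vanishing row and column sums\<close>

lemma less_3_cases: "(i::nat) < 3 \<Longrightarrow> i = 0 \<or> i = 1 \<or> i = 2"
  by auto

lemma less_4_cases: "(i::nat) < 4 \<Longrightarrow> i = 0 \<or> i = 1 \<or> i = 2 \<or> i = 3"
  by auto

text \<open>The head has length \<open>k = 7\<close> (the core) in the top three rows and
  \<open>k = 3\<close> in all other row and column sums; strips or squares supply the blocks of
  four.\<close>

lemma sum_lessThan_add_mult_4:
  fixes f :: "nat \<Rightarrow> 'a::comm_monoid_add"
  shows "(\<Sum>j<k + 4 * p. f j) = (\<Sum>j<k. f j) + (\<Sum>q<p. \<Sum>c<4. f (k + 4 * q + c))"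
  by (induction p) (simp_all add: numeral_eq_Suc algebra_simps)

lemma row_sum_core: "i < 3 \<Longrightarrow> (\<Sum>j<7. core R i j) = 0"
  by (drule less_3_cases) (auto simp: core_def numeral_eq_Suc)

lemma col_sum_core: "j < 7 \<Longrightarrow> (\<Sum>i<3. core R i j) = 0"
proof -
  assume "j < 7"
  then have "j = 0 \<or> j = 1 \<or> j = 2 \<or> j = 3 \<or> j = 4 \<or> j = 5 \<or> j = 6" by auto
  then show ?thesis by (auto simp: core_def numeral_eq_Suc)
qed

lemma row_sum_strip: "i < 3 \<Longrightarrow> (\<Sum>j<4. strip R r i j) = 0"
  by (drule less_3_cases) (auto simp: strip_def numeral_eq_Suc)

lemma col_sum_strip: "j < 4 \<Longrightarrow> (\<Sum>i<3. strip R r i j) = 0"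
  by (drule less_4_cases) (auto simp: strip_def numeral_eq_Suc)

text \<open>Along a row the second factor is an arithmetic progression with difference 2, along a
  column one with difference 8; the signs \<open>1, -1, -1, 1\<close> annihilate both.\<close>

lemma row_sum_square: "i < 4 \<Longrightarrow> (\<Sum>j<4. square i j * (u + 2 * int (v + 4 * i + j))) = 0"
  by (drule less_4_cases) (auto simp: square_def numeral_eq_Suc)

lemma col_sum_square: "j < 4 \<Longrightarrow> (\<Sum>i<4. square i j * (u + 2 * int (v + 4 * i + j))) = 0"
  by (drule less_4_cases) (auto simp: square_def numeral_eq_Suc)

context
  fixes a b :: nat and R :: int
  defines "R \<equiv> int a + int b + 1"
begin

lemma heffter_int_core: "i < 3 \<Longrightarrow> j < 7 \<Longrightarrow> heffter_int a b i j = core R i j"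
  by (simp add: heffter_int_def R_def Let_def)

lemma heffter_int_horizontal:
  "i < 3 \<Longrightarrow> c < 4 \<Longrightarrow> heffter_int a b i (7 + 4 * q + c) = strip R (int q) i c"
  by (simp add: heffter_int_def R_def Let_def)

lemma heffter_int_vertical:
  "j < 3 \<Longrightarrow> c < 4 \<Longrightarrow> heffter_int a b (3 + 4 * p + c) j = strip R (int (b + p)) j c"
  by (simp add: heffter_int_def R_def Let_def)

lemma heffter_int_square:
  "c < 4 \<Longrightarrow> d < 4 \<Longrightarrow> heffter_int a b (3 + 4 * p + c) (3 + 4 * q + d) =
     square c d * (12 * R + 24 + 2 * int (16 * (p * (b + 1) + q) + 4 * c + d))"
  by (simp add: heffter_int_def R_def Let_def)

text \<open>A top row is a core row followed by strip rows. A lower row begins with three cells that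
  form a column of a transposed strip and continues with rows of squares.\<close>

lemma row_sum_heffter_int: "(\<Sum>j<7 + 4 * b. heffter_int a b i j) = 0"
proof (cases "i < 3")
  case True
  then show ?thesis
    by (simp add: sum_lessThan_add_mult_4 heffter_int_core heffter_int_horizontal
        row_sum_core row_sum_strip)
next
  case False
  define p c where "p = (i - 3) div 4" and "c = (i - 3) mod 4"
  have i: "i = 3 + 4 * p + c" and c: "c < 4" using False by (auto simp: p_def c_def)
  have "(\<Sum>j<3 + 4 * (b + 1). heffter_int a b i j) = 0"
    unfolding sum_lessThan_add_mult_4 i
    by (simp add: heffter_int_vertical heffter_int_square c col_sum_strip row_sum_square
        del: of_nat_add of_nat_mult)
  then show ?thesis by (simp add: algebra_simps)
qed

lemma col_sum_heffter_int: "j < 7 + 4 * b \<Longrightarrow> (\<Sum>i<7 + 4 * a. heffter_int a b i j) = 0"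
proof -
  assume j: "j < 7 + 4 * b"
  have "(\<Sum>i<3 + 4 * (a + 1). heffter_int a b i j) = 0"
  proof (cases "j < 3")
    case True
    then show ?thesis
      unfolding sum_lessThan_add_mult_4
      by (simp add: heffter_int_core heffter_int_vertical col_sum_core row_sum_strip
          del: of_nat_add)
  next
    case False
    define q d where "q = (j - 3) div 4" and "d = (j - 3) mod 4"
    have jq: "j = 3 + 4 * q + d" and d: "d < 4" using False by (auto simp: q_def d_def)
    have top: "(\<Sum>i<3. heffter_int a b i j) = 0"
    proof (cases "j < 7")
      case True
      then show ?thesis by (simp add: heffter_int_core col_sum_core)
    next
      case False
      \<comment> \<open>Squares start at column 3 but horizontal strips at column 7, so the squares
        with index \<open>q\<close> lie below strip \<open>q - 1\<close>; \<open>q = 0\<close> would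
        give \<open>j < 7\<close>.\<close>
      then have "j = 7 + 4 * (q - 1) + d" using jq d by (cases q) auto
      then show ?thesis by (simp add: heffter_int_horizontal d col_sum_strip)
    qed
    show ?thesis
      unfolding sum_lessThan_add_mult_4 top unfolding jq
      by (simp add: heffter_int_square d col_sum_square del: of_nat_add of_nat_mult)
  qed
  then show ?thesis by (simp add: algebra_simps)
qed

section \<open>Absolute values occurring in the array\<close>

definition attained :: "int \<Rightarrow> bool" where
  "attained t \<longleftrightarrow> (\<exists>i<7 + 4 * a. \<exists>j<7 + 4 * b. \<bar>heffter_int a b i j\<bar> = t)"

lemma attainedI:
  "i < 7 + 4 * a \<Longrightarrow> j < 7 + 4 * b \<Longrightarrow> \<bar>heffter_int a b i j\<bar> = t \<Longrightarrow> attained t"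
  unfolding attained_def by blast

lemma attained_core: "i < 3 \<Longrightarrow> j < 7 \<Longrightarrow> \<bar>core R i j\<bar> = t \<Longrightarrow> attained t"
  by (rule attainedI[of i j]) (simp_all add: heffter_int_core)

text \<open>The strips of both arms share one numbering, with \<open>r < b\<close> horizontal and
  the rest vertical, so how \<open>R - 1\<close> splits into \<open>a\<close> and \<open>b\<close>
  does not matter from here on.\<close>

lemma attained_strip:
  assumes "0 \<le> r" "r < R" "i < 3" "c < 4" "\<bar>strip R r i c\<bar> = t"
  shows "attained t"
proof (cases "r < int b")
  case True
  then show ?thesis using assms
    by (intro attainedI[of i "7 + 4 * nat r + c"]) (auto simp: heffter_int_horizontal)
next
  case False
  then show ?thesis using assms
    by (intro attainedI[of "3 + 4 * nat (r - int b) + c" i])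
      (auto simp: heffter_int_vertical R_def)
qed

text \<open>The cell is read off from mixed-radix digits of \<open>t\<close>: \<open>p\<close> and
  \<open>q\<close> locate the square, \<open>c\<close> and \<open>d\<close> the cell inside
  it.\<close>

lemma attained_square:
  assumes "t < 16 * (a + 1) * (b + 1)"
  shows "attained (12 * R + 24 + 2 * int t)"
proof -
  define u c d p q where "u = t div 16" and "c = t mod 16 div 4" and "d = t mod 4"
    and "p = u div (b + 1)" and "q = u mod (b + 1)"
  have cd: "c < 4" "d < 4" by (auto simp: c_def d_def)
  have u: "u = p * (b + 1) + q" unfolding p_def q_def by (rule div_mult_mod_eq[symmetric])
  have t: "t = 16 * (p * (b + 1) + q) + 4 * c + d"
  proof -
    have "t mod 16 = 4 * c + d"
      using mult_div_mod_eq[of 4 "t mod 16"] by (simp add: c_def d_def mod_mod_cancel)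
    then show ?thesis using mult_div_mod_eq[of 16 t] unfolding u_def[symmetric] u by linarith
  qed
  have q: "q < b + 1" by (simp add: q_def)
  have "t < (a + 1) * (b + 1) * 16" using assms by (simp only: ac_simps)
  then have "u < (a + 1) * (b + 1)" unfolding u_def by (rule less_mult_imp_div_less)
  then have p: "p < a + 1" unfolding p_def by (rule less_mult_imp_div_less)
  have sq: "\<bar>square c d\<bar> = 1"
    using cd by (auto dest!: less_4_cases simp: square_def)
  show ?thesis
    using cd p q
    by (intro attainedI[of "3 + 4 * p + c" "3 + 4 * q + d"])
      (simp_all add: heffter_int_square abs_mult sq R_def t)
qed

lemma attained_core_values:
  "attained (3 * R + 6)"
  "attained (9 * R + 13)"
  "attained (6 * R + 10)"
  "attained (11 * R + 17)"
  "attained (9 * R + 15)"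
  "attained (9 * R + 14)"
  "attained (7 * R + 11)"
  "attained (9 * R + 16)"
  "attained (12 * R + 20)"
  "attained (8 * R + 12)"
  "attained (1)"
  "attained (12 * R + 19)"
  "attained (3 * R + 5)"
  "attained (2 * R + 3)"
  "attained (12 * R + 22)"
  "attained (3 * R + 7)"
  "attained (2 * R + 2)"
  "attained (11 * R + 18)"
  "attained (3 * R + 4)"
  "attained (6 * R + 9)"
  "attained (5 * R + 8)"
proof -
  have R: "R \<ge> 1" by (simp add: R_def)
  show "attained (3 * R + 6)" using R by (intro attained_core[of 0 0]) (simp_all add: core_def)
  show "attained (9 * R + 13)" using R by (intro attained_core[of 0 1]) (simp_all add: core_def)
  show "attained (6 * R + 10)" using R by (intro attained_core[of 0 2]) (simp_all add: core_def)
  show "attained (11 * R + 17)" using R by (intro attained_core[of 0 3]) (simp_all add: core_def)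
  show "attained (9 * R + 15)" using R by (intro attained_core[of 0 4]) (simp_all add: core_def)
  show "attained (9 * R + 14)" using R by (intro attained_core[of 0 5]) (simp_all add: core_def)
  show "attained (7 * R + 11)" using R by (intro attained_core[of 0 6]) (simp_all add: core_def)
  show "attained (9 * R + 16)" using R by (intro attained_core[of 1 0]) (simp_all add: core_def)
  show "attained (12 * R + 20)" using R by (intro attained_core[of 1 1]) (simp_all add: core_def)
  show "attained (8 * R + 12)" using R by (intro attained_core[of 1 2]) (simp_all add: core_def)
  show "attained (1)" using R by (intro attained_core[of 1 3]) (simp_all add: core_def)
  show "attained (12 * R + 19)" using R by (intro attained_core[of 1 4]) (simp_all add: core_def)
  show "attained (3 * R + 5)" using R by (intro attained_core[of 1 5]) (simp_all add: core_def)
  show "attained (2 * R + 3)" using R by (intro attained_core[of 1 6]) (simp_all add: core_def)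
  show "attained (12 * R + 22)" using R by (intro attained_core[of 2 0]) (simp_all add: core_def)
  show "attained (3 * R + 7)" using R by (intro attained_core[of 2 1]) (simp_all add: core_def)
  show "attained (2 * R + 2)" using R by (intro attained_core[of 2 2]) (simp_all add: core_def)
  show "attained (11 * R + 18)" using R by (intro attained_core[of 2 3]) (simp_all add: core_def)
  show "attained (3 * R + 4)" using R by (intro attained_core[of 2 4]) (simp_all add: core_def)
  show "attained (6 * R + 9)" using R by (intro attained_core[of 2 5]) (simp_all add: core_def)
  show "attained (5 * R + 8)" using R by (intro attained_core[of 2 6]) (simp_all add: core_def)
qed

lemma attained_strip_values:
  assumes "0 \<le> r" "r < R"
  shows "attained (7 * R + 12 + r)"
    "attained (11 * R + 16 - r)"
    "attained (2 * R + 4 + r)"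
    "attained (6 * R + 8 - r)"
    "attained (9 * R + 12 - r)"
    "attained (11 * R + 19 + r)"
    "attained (7 * R + 10 - r)"
    "attained (9 * R + 17 + r)"
    "attained (2 * R - 2 * r)"
    "attained (3 + 2 * r)"
    "attained (5 * R + 6 - 2 * r)"
    "attained (3 * R + 9 + 2 * r)"
proof -
  show "attained (7 * R + 12 + r)"
    using assms by (intro attained_strip[of r 0 0]) (simp_all add: strip_def)
  show "attained (11 * R + 16 - r)"
    using assms by (intro attained_strip[of r 0 1]) (simp_all add: strip_def)
  show "attained (2 * R + 4 + r)"
    using assms by (intro attained_strip[of r 0 2]) (simp_all add: strip_def)
  show "attained (6 * R + 8 - r)"
    using assms by (intro attained_strip[of r 0 3]) (simp_all add: strip_def)
  show "attained (9 * R + 12 - r)"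
    using assms by (intro attained_strip[of r 1 0]) (simp_all add: strip_def)
  show "attained (11 * R + 19 + r)"
    using assms by (intro attained_strip[of r 1 1]) (simp_all add: strip_def)
  show "attained (7 * R + 10 - r)"
    using assms by (intro attained_strip[of r 1 2]) (simp_all add: strip_def)
  show "attained (9 * R + 17 + r)"
    using assms by (intro attained_strip[of r 1 3]) (simp_all add: strip_def)
  show "attained (2 * R - 2 * r)"
    using assms by (intro attained_strip[of r 2 0]) (simp_all add: strip_def)
  show "attained (3 + 2 * r)"
    using assms by (intro attained_strip[of r 2 1]) (simp_all add: strip_def)
  show "attained (5 * R + 6 - 2 * r)"
    using assms by (intro attained_strip[of r 2 2]) (simp_all add: strip_def)
  show "attained (3 * R + 9 + 2 * r)"
    using assms by (intro attained_strip[of r 2 3]) (simp_all add: strip_def)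
qed

text \<open>The runs of strip values and the isolated core values fit together without gaps up to
  \<open>12 * R + 20\<close>; the core also supplies \<open>12 * R + 22\<close>.\<close>

lemma attained_L_shape:
  assumes "1 \<le> t" "t \<le> 12 * R + 20 \<or> t = 12 * R + 22"
  shows "attained t"
proof -
  have R: "R \<ge> 1" by (simp add: R_def)
  \<comment> \<open>In \<open>sa\<close> to \<open>sh\<close> one strip entry at a time is solved
    for \<open>r\<close>; with \<open>0 \<le> r < R\<close> it fills an interval of length
    \<open>R\<close>.\<close>
  have sa: "attained t" if "2 * R + 4 \<le> t" "t \<le> 3 * R + 3"
    using attained_strip_values(3)[of "t - (2 * R + 4)"] that by (simp add: algebra_simps)
  have sb: "attained t" if "5 * R + 9 \<le> t" "t \<le> 6 * R + 8"
    using attained_strip_values(4)[of "6 * R + 8 - t"] that by (simp add: algebra_simps)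
  have sc: "attained t" if "6 * R + 11 \<le> t" "t \<le> 7 * R + 10"
    using attained_strip_values(7)[of "7 * R + 10 - t"] that by (simp add: algebra_simps)
  have sd: "attained t" if "7 * R + 12 \<le> t" "t \<le> 8 * R + 11"
    using attained_strip_values(1)[of "t - (7 * R + 12)"] that by (simp add: algebra_simps)
  have se: "attained t" if "8 * R + 13 \<le> t" "t \<le> 9 * R + 12"
    using attained_strip_values(5)[of "9 * R + 12 - t"] that by (simp add: algebra_simps)
  have sf: "attained t" if "9 * R + 17 \<le> t" "t \<le> 10 * R + 16"
    using attained_strip_values(8)[of "t - (9 * R + 17)"] that by (simp add: algebra_simps)
  have sg: "attained t" if "10 * R + 17 \<le> t" "t \<le> 11 * R + 16"
    using attained_strip_values(2)[of "11 * R + 16 - t"] that by (simp add: algebra_simps)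
  have sh: "attained t" if "11 * R + 19 \<le> t" "t \<le> 12 * R + 18"
    using attained_strip_values(6)[of "t - (11 * R + 19)"] that by (simp add: algebra_simps)
  \<comment> \<open>Two progressions of step 2 interleave: \<open>2 * R - 2 * r\<close> gives the
    even values, \<open>3 + 2 * r\<close> the odd ones.\<close>
  have low: "attained t" if "2 \<le> t" "t \<le> 2 * R + 1"
  proof (cases "even t")
    case True
    then obtain s where "t = 2 * s" by auto
    then show ?thesis using attained_strip_values(9)[of "R - s"] that by (simp add: algebra_simps)
  next
    case False
    then obtain s where "t = 2 * s + 1" by (rule oddE)
    then show ?thesis using attained_strip_values(10)[of "s - 1"] that by (simp add: algebra_simps)
  qed
  have mid: "attained t" if "3 * R + 8 \<le> t" "t \<le> 5 * R + 7"
  \<comment> \<open>Here the two step-2 progressions differ in parity relative to \<open>R\<close>: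
    \<open>5 * R + 6 - 2 * r\<close> is congruent to \<open>R\<close> modulo 2,
    \<open>3 * R + 9 + 2 * r\<close> is not.\<close>
  proof (cases "even (t - R)")
    case True
    then have "even (5 * R + 6 - t)" by (simp add: algebra_simps)
    then obtain s where "5 * R + 6 - t = 2 * s" by (rule evenE)
    moreover from this have "t = 5 * R + 6 - 2 * s" by simp
    ultimately show ?thesis using attained_strip_values(11)[of s] that True by simp
  next
    case False
    then have "even (t - (3 * R + 9))" by simp
    then obtain s where s: "t - (3 * R + 9) = 2 * s" by (rule evenE)
    then have "t = 3 * R + 9 + 2 * s" by simp
    moreover have "t \<noteq> 3 * R + 8" using False by auto
    ultimately show ?thesis using attained_strip_values(12)[of s] that by simp
  qed
  \<comment> \<open>From \<open>u1\<close> to \<open>u20\<close> the upper bound grows by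
    alternately adjoining core values and strip runs.\<close>
  have u1: "attained t" if "t \<le> 1"
    using attained_core_values(11) that assms(1) by (cases "t = 1") simp_all
  have u2: "attained t" if "t \<le> 2 * R + 1"
    using u1 low that by (cases "t \<le> 1") simp_all
  have u3: "attained t" if "t \<le> 2 * R + 3"
  proof -
    have "t \<le> 2 * R + 1 \<or> t = 2 * R + 2 \<or> t = 2 * R + 3"
      using that by linarith
    then show ?thesis using u2 attained_core_values(17, 14) by auto
  qed
  have u4: "attained t" if "t \<le> 3 * R + 3"
    using u3 sa that by (cases "t \<le> 2 * R + 3") simp_all
  have u5: "attained t" if "t \<le> 3 * R + 7"
  proof -
    have "t \<le> 3 * R + 3 \<or> t = 3 * R + 4 \<or> t = 3 * R + 5 \<or> t = 3 * R + 6 \<or> t = 3 * R + 7"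
      using that by linarith
    then show ?thesis using u4 attained_core_values(19, 13, 1, 16) by auto
  qed
  have u6: "attained t" if "t \<le> 5 * R + 7"
    using u5 mid that by (cases "t \<le> 3 * R + 7") simp_all
  have u7: "attained t" if "t \<le> 5 * R + 8"
  proof -
    have "t \<le> 5 * R + 7 \<or> t = 5 * R + 8"
      using that by linarith
    then show ?thesis using u6 attained_core_values(21) by auto
  qed
  have u8: "attained t" if "t \<le> 6 * R + 8"
    using u7 sb that by (cases "t \<le> 5 * R + 8") simp_all
  have u9: "attained t" if "t \<le> 6 * R + 10"
  proof -
    have "t \<le> 6 * R + 8 \<or> t = 6 * R + 9 \<or> t = 6 * R + 10"
      using that by linarith
    then show ?thesis using u8 attained_core_values(20, 3) by auto
  qed
  have u10: "attained t" if "t \<le> 7 * R + 10"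
    using u9 sc that by (cases "t \<le> 6 * R + 10") simp_all
  have u11: "attained t" if "t \<le> 7 * R + 11"
  proof -
    have "t \<le> 7 * R + 10 \<or> t = 7 * R + 11"
      using that by linarith
    then show ?thesis using u10 attained_core_values(7) by auto
  qed
  have u12: "attained t" if "t \<le> 8 * R + 11"
    using u11 sd that by (cases "t \<le> 7 * R + 11") simp_all
  have u13: "attained t" if "t \<le> 8 * R + 12"
  proof -
    have "t \<le> 8 * R + 11 \<or> t = 8 * R + 12"
      using that by linarith
    then show ?thesis using u12 attained_core_values(10) by auto
  qed
  have u14: "attained t" if "t \<le> 9 * R + 12"
    using u13 se that by (cases "t \<le> 8 * R + 12") simp_all
  have u15: "attained t" if "t \<le> 9 * R + 16"
  proof -
    have "t \<le> 9 * R + 12 \<or> t = 9 * R + 13 \<or> t = 9 * R + 14 \<or> t = 9 * R + 15 \<or> t = 9 * R + 16"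
      using that by linarith
    then show ?thesis using u14 attained_core_values(2, 6, 5, 8) by auto
  qed
  have u16: "attained t" if "t \<le> 10 * R + 16"
    using u15 sf that by (cases "t \<le> 9 * R + 16") simp_all
  have u17: "attained t" if "t \<le> 11 * R + 16"
    using u16 sg that by (cases "t \<le> 10 * R + 16") simp_all
  have u18: "attained t" if "t \<le> 11 * R + 18"
  proof -
    have "t \<le> 11 * R + 16 \<or> t = 11 * R + 17 \<or> t = 11 * R + 18"
      using that by linarith
    then show ?thesis using u17 attained_core_values(4, 18) by auto
  qed
  have u19: "attained t" if "t \<le> 12 * R + 18"
    using u18 sh that by (cases "t \<le> 11 * R + 18") simp_all
  have u20: "attained t" if "t \<le> 12 * R + 20"
  proof -
    have "t \<le> 12 * R + 18 \<or> t = 12 * R + 19 \<or> t = 12 * R + 20"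
      using that by linarith
    then show ?thesis using u19 attained_core_values(12, 9) by auto
  qed
  show ?thesis using assms(2) u20 attained_core_values(15) by auto
qed

lemma heffter_int_cover:
  defines "N \<equiv> int ((7 + 4 * a) * (7 + 4 * b))"
  assumes x: "1 \<le> x" "x \<le> N"
  shows "attained x \<or> attained (2 * N + 1 - x)"
proof -
  define S where "S = int (16 * (a + 1) * (b + 1))"
  \<comment> \<open>The L-shape has \<open>12 * R + 21\<close> cells, the squares together have
    \<open>S\<close>.\<close>
  have N: "N = 12 * R + 21 + S" by (simp add: N_def R_def S_def algebra_simps)
  have "1 * 1 \<le> (a + 1) * (b + 1)" by (rule mult_le_mono) simp_all
  then have S: "S \<ge> 16" unfolding S_def by linarith
  have even: "attained y" if y: "even y" "12 * R + 24 \<le> y" "y \<le> 12 * R + 22 + 2 * S" for y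
  proof -
    obtain h where "y = 2 * h" using y(1) by (rule evenE)
    moreover define s where "s = h - 6 * R - 12"
    ultimately have s: "y = 12 * R + 24 + 2 * s" by simp
    with y(2,3) have "nat s < 16 * (a + 1) * (b + 1)" "s \<ge> 0"
      unfolding S_def by linarith+
    then show ?thesis using attained_square[of "nat s"] s by simp
  qed
  show ?thesis
  proof (cases "x \<le> 12 * R + 20 \<or> x = 12 * R + 22")
    case True
    then show ?thesis using attained_L_shape x by blast
  next
    case False
    show ?thesis
    proof (cases "even x")
      case True
      \<comment> \<open>Parity excludes 21 and 23 above \<open>12 * R\<close>, so an even
        \<open>x\<close> outside the L-shape values is at least \<open>12 * R + 24\<close>, where
        the square values begin.\<close>
      then have "x \<noteq> 12 * R + 23" by auto
      moreover have "x \<noteq> 12 * R + 21" using True by auto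
      ultimately show ?thesis using even[OF True] False x N S by linarith
    next
      case odd: False
      \<comment> \<open>The bound is sharp: the smallest missing odd value
        \<open>12 * R + 21\<close> corresponds to the largest square value
        \<open>12 * R + 22 + 2 * S\<close>.\<close>
      then have "even (2 * N + 1 - x)" by simp
      moreover have "2 * N + 1 - x \<le> 12 * R + 22 + 2 * S" using False N by linarith
      moreover have "12 * R + 24 \<le> 2 * N + 1 - x" using x N S by linarith
      ultimately show ?thesis using even by blast
    qed
  qed
qed

end

section \<open>From integers to residues modulo \<open>2 * m * n + 1\<close>\<close>

theorem theorem11:
  fixes m n :: nat
  assumes "m \<ge> 7" and "n \<ge> 7"
    and "[m = 3] (mod 4)" and "[n = 3] (mod 4)"
  shows "\<exists>A. heffter_array m n A"
proof -
  obtain a where m: "m = 7 + 4 * a"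
  proof
    show "m = 7 + 4 * ((m - 7) div 4)" using assms(1,3) unfolding cong_def by presburger
  qed
  obtain b where n: "n = 7 + 4 * b"
  proof
    show "n = 7 + 4 * ((n - 7) div 4)" using assms(2,4) unfolding cong_def by presburger
  qed
  show ?thesis
  proof (rule heffter_arrayI[where B = "heffter_int a b"])
    fix i assume "i < m"
    show "[(\<Sum>j<n. heffter_int a b i j) = 0] (mod int (2 * m * n + 1))"
      by (simp add: n row_sum_heffter_int)
  next
    fix j assume "j < n"
    then show "[(\<Sum>i<m. heffter_int a b i j) = 0] (mod int (2 * m * n + 1))"
      by (simp add: m n col_sum_heffter_int)
  next
    fix x :: int assume x: "1 \<le> x" "x \<le> int (m * n)"
    define M where "M = int (2 * m * n + 1)"
    have "attained a b x \<or> attained a b (M - x)"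
      using heffter_int_cover[of x a b] x by (simp add: M_def m n algebra_simps)
    then obtain i j where ij: "i < m" "j < n"
      and *: "\<bar>heffter_int a b i j\<bar> = x \<or> \<bar>heffter_int a b i j\<bar> = M - x"
      unfolding attained_def m n by blast
    consider "heffter_int a b i j = x" | "heffter_int a b i j = - x"
      | "heffter_int a b i j = M - x" | "heffter_int a b i j = x - M"
      using * by linarith
    then have "[heffter_int a b i j = x] (mod M) \<or> [heffter_int a b i j = - x] (mod M)"
      by cases (simp_all add: cong_iff_dvd_diff)
    then show "\<exists>i<m. \<exists>j<n. [heffter_int a b i j = x] (mod int (2 * m * n + 1)) \<or>
        [heffter_int a b i j = - x] (mod int (2 * m * n + 1))"
      using ij unfolding M_def by blast
  qed
qed

end
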